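(* Let $\{a_n\}_{n=1}^{\infty}$ be a sequence of nonzero complex numbers. Let $\{c_n\}_{n=1}^{\infty}$ and $\{\beta_n\}_{n=1}^{\infty}$ be sequences of real numbers with $c_n>0$ and $0<\beta_n<1$ for all $n\ge 1$. Suppose that either, for all $n\ge 1$, \[ |a_{2n}|\ge \frac{c_n+1}{1-\beta_n},\qquad |a_{2n+1}|\le \min\left\{ c_n,\ c_{n+1},\ \beta_n\beta_{n+1}\frac{c_{n+1}+1}{4(1-\beta_{n+1})},\ \beta_n\beta_{n+1}\frac{c_n+1}{4(1-\beta_n)}\right\}, \] or, for all $n\ge 1$, \[ |a_{2n}|\ge \max\left\{\frac{c_n+1}{1-\beta_n},\ \frac{c_{n+1}+1}{1-\beta_{n+1}}\right\},\qquad |a_{2n+1}|\le \min\left\{ c_n,\ c_{n+1},\ \beta_n\beta_{n+1}\frac{c_{n+1}+1}{4(1-\beta_{n+1})}\right\}. \] Then the continued fraction $K_{n=1}^{\infty} a_n/1$ converges to a finite value.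
   Context: For complex numbers $a_n$, $K_{n=1}^{\infty} a_n/1$ denotes the continued fraction $\cfrac{a_1}{1+\cfrac{a_2}{1+\cfrac{a_3}{1+\cdots}}}$. Its $N$-th approximant is $A_N/B_N$, where $A_N=A_{N-1}+a_NA_{N-2}$, $B_N=B_{N-1}+a_NB_{N-2}$, with $A_{-1}=1$, $A_0=0$, $B_{-1}=0$, $B_0=1$. The continued fraction converges to a finite value if the sequence of approximants $A_N/B_N$ converges to a finite complex number. *)

theory Defs
  imports Complex_Main
begin

text \<open>Sequences are used from index 1 on; the value \<open>a 0\<close> plays no role.
  The index of the canonical numerators and denominators is shifted by one, so that the
  recursion can start at \<open>A\<^sub>-\<^sub>1\<close>, \<open>B\<^sub>-\<^sub>1\<close>: \<open>cf_num a (N + 1)\<close> is \<open>A\<^sub>N\<close>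
  and \<open>cf_den a (N + 1)\<close> is \<open>B\<^sub>N\<close>.\<close>

fun cf_num :: "(nat \<Rightarrow> complex) \<Rightarrow> nat \<Rightarrow> complex" where
  "cf_num a 0 = 1"
| "cf_num a (Suc 0) = 0"
| "cf_num a (Suc (Suc n)) = cf_num a (Suc n) + a (Suc n) * cf_num a n"

fun cf_den :: "(nat \<Rightarrow> complex) \<Rightarrow> nat \<Rightarrow> complex" where
  "cf_den a 0 = 0"
| "cf_den a (Suc 0) = 1"
| "cf_den a (Suc (Suc n)) = cf_den a (Suc n) + a (Suc n) * cf_den a n"

definition cf_approximant :: "(nat \<Rightarrow> complex) \<Rightarrow> nat \<Rightarrow> complex" where
  "cf_approximant a N = cf_num a (N + 1) / cf_den a (N + 1)"

text \<open>An approximant with vanishing denominator is not a finite number, whereas division by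
  zero yields \<open>0\<close> in HOL. Hence the requirement that only finitely many
  denominators vanish.\<close>

definition cf_converges_finite :: "(nat \<Rightarrow> complex) \<Rightarrow> bool" where
  "cf_converges_finite a \<longleftrightarrow>
     (\<forall>\<^sub>F N in sequentially. cf_den a (N + 1) \<noteq> 0) \<and> convergent (cf_approximant a)"

end

theory Submission
  imports Defs "HOL-Probability.Characteristic_Functions"
begin

text \<open>The denominators of even index, and likewise those of odd index, satisfy a three-term
  recurrence whose normalised coefficients have modulus at most 1/4 (Worpitzky's condition). This
  makes the denominators grow at least like \<open>(n + 1) / 2 ^ n\<close> times the product
  of the numbers \<open>\<beta> k * norm (a (2 * k))\<close>. By the determinant formula the even approximants
  then have increments of order \<open>1 / n\<^sup>2\<close>, and neighbouring approximants of even and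
  odd index differ by the same order, so both subsequences converge to the same limit.\<close>

text \<open>Each step of the recursion multiplies the determinant by \<open>- a (Suc n)\<close>; its
  initial value is -1, and the norm discards the signs. The numerator of a difference of consecutive
  approximants is thereby explicit.\<close>

lemma cf_determinant:
  "norm (cf_num a (Suc n) * cf_den a n - cf_num a n * cf_den a (Suc n)) = (\<Prod>k=1..n. norm (a k))"
proof (induction n)
  case 0
  show ?case by simp
next
  case (Suc n)
  have "cf_num a (Suc (Suc n)) * cf_den a (Suc n) - cf_num a (Suc n) * cf_den a (Suc (Suc n))
    = - a (Suc n) * (cf_num a (Suc n) * cf_den a n - cf_num a n * cf_den a (Suc n))"
    by (simp add: algebra_simps)
  then show ?case
    using Suc.IH by (simp add: norm_mult mult.commute)
qed

text \<open>The denominators at \<open>n + 1\<close> and \<open>n + 3\<close> are eliminated, which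
  leaves a recurrence among indices of one parity.\<close>

lemma cf_den_two_step:
  "cf_den a (n + 4) = (1 + a (n + 2) + a (n + 3)) * cf_den a (n + 2) - a (n + 1) * a (n + 2) * cf_den a n"
  by (simp add: numeral_eq_Suc algebra_simps)

text \<open>The factor \<open>(n + 2) / (2 * (n + 1))\<close> is the ratio of consecutive denominators
  in the extremal case where all coefficients equal -1/4.\<close>

lemma three_term_ratio_lower:
  fixes X :: "nat \<Rightarrow> 'a::real_normed_field"
  assumes q: "\<And>n. q n > 0"
    and X1: "norm (X 1) \<ge> q 0 * norm (X 0)"
    and rec: "\<And>n. X (n + 2) = u n * X (n + 1) - v n * X n"
    and u: "\<And>n. norm (u n) \<ge> q (n + 1)"
    and v: "\<And>n. norm (v n) \<le> q n * q (n + 1) / 4"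
  shows "real (n + 2) * q n * norm (X n) \<le> 2 * real (n + 1) * norm (X (n + 1))"
proof (induction n)
  case 0
  show ?case using X1 by simp
next
  case (Suc n)
  let ?y = "norm (X (n + 1))"
  \<comment> \<open>By the induction hypothesis the subtracted term takes away at most the fraction
    (n+1)/(2(n+2)) of \<open>q (n + 1) * ?y\<close>. What remains is (n+3)/(2(n+2)), exactly the
    next ratio.\<close>
  have "real (n + 2) * norm (v n * X n) \<le> real (n + 2) * (q n * q (n + 1) / 4 * norm (X n))"
    unfolding norm_mult using v[of n] by (intro mult_left_mono mult_right_mono) auto
  also have "\<dots> = q (n + 1) / 4 * (real (n + 2) * q n * norm (X n))"
    by simp
  also have "\<dots> \<le> q (n + 1) / 4 * (2 * real (n + 1) * ?y)"
    using Suc.IH q[of "n + 1"] by (intro mult_left_mono) auto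
  finally have v': "2 * real (n + 2) * norm (v n * X n) \<le> real (n + 1) * (q (n + 1) * ?y)"
    by (simp add: algebra_simps)
  have "q (n + 1) * ?y - norm (v n * X n) \<le> norm (u n * X (n + 1)) - norm (v n * X n)"
    using u[of n] by (simp add: norm_mult mult_right_mono)
  also have "\<dots> \<le> norm (X (n + 2))"
    unfolding rec by (rule norm_triangle_ineq2)
  finally have "2 * real (n + 2) * (q (n + 1) * ?y - norm (v n * X n)) \<le> 2 * real (n + 2) * norm (X (n + 2))"
    by (intro mult_left_mono) auto
  with v' show ?case
    by (simp add: algebra_simps)
qed

text \<open>The ratio bounds are multiplied together: the product of (k+2)/(2(k+1)) over k < n
  telescopes to (n+1)/2^n.\<close>

lemma three_term_lower:
  fixes X :: "nat \<Rightarrow> 'a::real_normed_field"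
  assumes q: "\<And>n. q n > 0"
    and X1: "norm (X 1) \<ge> q 0 * norm (X 0)"
    and rec: "\<And>n. X (n + 2) = u n * X (n + 1) - v n * X n"
    and u: "\<And>n. norm (u n) \<ge> q (n + 1)"
    and v: "\<And>n. norm (v n) \<le> q n * q (n + 1) / 4"
  shows "real (n + 1) / 2 ^ n * (\<Prod>k<n. q k) * norm (X 0) \<le> norm (X n)"
proof (induction n)
  case 0
  show ?case by simp
next
  case (Suc n)
  have "real (n + 2) / 2 ^ (n + 1) * (\<Prod>k<n + 1. q k) * norm (X 0)
    = real (n + 2) * q n / (2 * real (n + 1)) * (real (n + 1) / 2 ^ n * (\<Prod>k<n. q k) * norm (X 0))"
    by (simp add: field_simps del: of_nat_add of_nat_Suc)
  also have "\<dots> \<le> real (n + 2) * q n / (2 * real (n + 1)) * norm (X n)"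
    using Suc.IH q[of n] by (intro mult_left_mono) auto
  also have "\<dots> \<le> norm (X (n + 1))"
    using three_term_ratio_lower[of q X u v n, OF assms]
    by (simp add: field_simps)
  finally show ?case by simp
qed

text \<open>Common core of both alternatives of the theorem, with \<open>b n\<close> in the role of
  \<beta>_{n+1}. The bounds \<open>first\<close>, \<open>even\<close> and \<open>odd\<close> control
  the initial ratios and the leading coefficients of the two-step recurrences;
  \<open>small_left\<close> and \<open>small_right\<close> control their product
  coefficients.\<close>

lemma cf_converges_finite_of_bounds:
  fixes a :: "nat \<Rightarrow> complex" and b :: "nat \<Rightarrow> real"
  assumes b: "\<And>n. 0 < b n" "\<And>n. b n \<le> 1"
    and large: "\<And>n. norm (a (2 * n + 2)) \<ge> 1"
    and first: "norm (1 + a 2) \<ge> b 0 * norm (a 2)"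
    and even: "\<And>n. norm (1 + a (2 * n + 3) + a (2 * n + 4)) \<ge> b (n + 1) * norm (a (2 * n + 4))"
    and odd: "\<And>n. norm (1 + a (2 * n + 2) + a (2 * n + 3)) \<ge> b n * norm (a (2 * n + 2))"
    and small_left: "\<And>n. norm (a (2 * n + 3)) \<le> b n * b (n + 1) * norm (a (2 * n + 2)) / 4"
    and small_right: "\<And>n. norm (a (2 * n + 3)) \<le> b n * b (n + 1) * norm (a (2 * n + 4)) / 4"
  shows "cf_converges_finite a"
proof -
  \<comment> \<open>One normalisation serves both parities, so B_{2n} and B_{2n+1} receive the same
    lower bound.\<close>
  define q where "q n = b n * norm (a (2 * n + 2))" for n
  define Q where "Q n = (\<Prod>k<n. q k)" for n
  have q: "q n > 0" for n
    using b[of n] large[of n] unfolding q_def by (intro mult_pos_pos) linarith+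
  have Q: "Q n > 0" for n
    unfolding Q_def using q by (intro prod_pos) auto
  \<comment> \<open>By the index shift this is B_{2n}. Its product coefficient is
    \<open>a (2 * n + 2) * a (2 * n + 3)\<close>, so the second factor must be compared with
    \<open>a (2 * n + 4)\<close>, whence \<open>small_right\<close>.\<close>
  have even_lower: "real (n + 1) / 2 ^ n * Q n \<le> norm (cf_den a (2 * n + 1))" for n
  proof -
    have "norm (a (2 * n + 2) * a (2 * n + 3)) \<le> q n * q (n + 1) / 4" for n
      using mult_left_mono[OF small_right[of n], of "norm (a (2 * n + 2))"]
      by (simp add: q_def norm_mult mult_ac numeral_eq_Suc)
    then have "real (n + 1) / 2 ^ n * (\<Prod>k<n. q k) * norm (cf_den a (2 * 0 + 1)) \<le> norm (cf_den a (2 * n + 1))"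
      using first even q cf_den_two_step[of a "2 * n + 1" for n]
      by (intro three_term_lower[where q = q and X = "\<lambda>n. cf_den a (2 * n + 1)"
            and u = "\<lambda>n. 1 + a (2 * n + 3) + a (2 * n + 4)" and v = "\<lambda>n. a (2 * n + 2) * a (2 * n + 3)"])
        (simp_all add: q_def numeral_eq_Suc)
    then show ?thesis by (simp add: Q_def)
  qed
  \<comment> \<open>For B_{2n+1} the product coefficient is
    \<open>a (2 * n + 3) * a (2 * n + 4)\<close>, whence \<open>small_left\<close>. The bound
    \<open>odd\<close> at 0 gives the initial ratio, at later indices the leading
    coefficients.\<close>
  have odd_lower: "real (n + 1) / 2 ^ n * Q n \<le> norm (cf_den a (2 * n + 2))" for n
  proof -
    have "norm (a (2 * n + 3) * a (2 * n + 4)) \<le> q n * q (n + 1) / 4" for n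
      using mult_right_mono[OF small_left[of n], of "norm (a (2 * n + 4))"]
      by (simp add: q_def norm_mult mult_ac numeral_eq_Suc)
    then have "real (n + 1) / 2 ^ n * (\<Prod>k<n. q k) * norm (cf_den a (2 * 0 + 2)) \<le> norm (cf_den a (2 * n + 2))"
      using odd[of 0] odd[of "Suc n" for n] q cf_den_two_step[of a "2 * n + 2" for n]
      by (intro three_term_lower[where q = q and X = "\<lambda>n. cf_den a (2 * n + 2)"
            and u = "\<lambda>n. 1 + a (2 * n + 4) + a (2 * n + 5)" and v = "\<lambda>n. a (2 * n + 3) * a (2 * n + 4)"])
        (simp_all add: q_def numeral_eq_Suc)
    then show ?thesis by (simp add: Q_def numeral_eq_Suc)
  qed
  have den_pos: "real (n + 1) / 2 ^ n * Q n > 0" for n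
    using Q[of n] by simp
  have even_nz: "cf_den a (2 * n + 1) \<noteq> 0" and odd_nz: "cf_den a (2 * n + 2) \<noteq> 0" for n
    using den_pos[of n] even_lower[of n] odd_lower[of n] by auto
  have nz: "cf_den a (N + 1) \<noteq> 0" for N
    using even_nz odd_nz by (cases "even N") (auto elim!: evenE oddE)

  define P where "P n = (\<Prod>k=1..2 * n + 1. norm (a k))" for n
  have P0: "P n \<ge> 0" for n
    unfolding P_def by (intro prod_nonneg) auto
  \<comment> \<open>By \<open>small_left\<close>, passing to \<open>Suc n\<close> multiplies
    \<open>P n\<close> by at most \<open>b (n + 1) / (4 * b n)\<close> times the square of
    \<open>q n\<close>. The quotients of \<open>b\<close> telescope; the resulting factor
    \<open>b n\<close> is kept for the even increments.\<close>
  have P: "P n * b 0 * 4 ^ n \<le> norm (a 1) * b n * (Q n)\<^sup>2" for n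
  proof (induction n)
    case 0
    show ?case by (simp add: P_def Q_def)
  next
    case (Suc n)
    let ?x = "norm (a (2 * n + 2))"
    have "P (Suc n) * b 0 * 4 ^ Suc n = (P n * b 0 * 4 ^ n) * (4 * ?x * norm (a (2 * n + 3)))"
      by (simp add: P_def numeral_eq_Suc)
    also have "\<dots> \<le> (norm (a 1) * b n * (Q n)\<^sup>2) * (4 * ?x * (b n * b (n + 1) * ?x / 4))"
      using small_left[of n] b[of n] P0[of n] b(1)[of 0] by (intro mult_mono Suc.IH) auto
    also have "\<dots> = norm (a 1) * b (Suc n) * (Q (Suc n))\<^sup>2"
      by (simp add: Q_def q_def power2_eq_square)
    finally show ?case .
  qed
  define C where "C = norm (a 1) / b 0"
  have P': "P n * 4 ^ n \<le> C * b n * (Q n)\<^sup>2" for n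
    using P[of n] b(1)[of 0] by (simp add: C_def field_simps)
  have C: "C \<ge> 0" using b(1)[of 0] by (simp add: C_def)
  have odd_even: "norm (cf_approximant a (2 * n + 1) - cf_approximant a (2 * n)) \<le> C * (1 / real (n + 1) ^ 2)" for n
  proof -
    have "norm (cf_approximant a (2 * n + 1) - cf_approximant a (2 * n))
      = P n / (norm (cf_den a (2 * n + 2)) * norm (cf_den a (2 * n + 1)))"
      using even_nz[of n] odd_nz[of n] cf_determinant[of a "2 * n + 1"]
      by (simp add: cf_approximant_def diff_frac_eq norm_divide norm_mult P_def)
    also have "\<dots> \<le> P n / ((real (n + 1) / 2 ^ n * Q n) * (real (n + 1) / 2 ^ n * Q n))"
      using even_lower[of n] odd_lower[of n] even_nz[of n] odd_nz[of n] Q[of n] P0[of n]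
      by (intro divide_left_mono mult_mono mult_pos_pos) auto
    \<comment> \<open>The two factors 2^n combine to the 4^n of \<open>P'\<close>, and the linear
      factors n+1 supply the quadratic decay.\<close>
    also have "\<dots> = P n * 4 ^ n / (Q n)\<^sup>2 * (1 / real (n + 1) ^ 2)"
      by (simp add: power2_eq_square flip: power_mult_distrib)
    also have "\<dots> \<le> C * b n * (1 / real (n + 1) ^ 2)"
      using P'[of n] Q[of n] by (intro mult_right_mono) (auto simp: field_simps)
    also have "\<dots> \<le> C * 1 * (1 / real (n + 1) ^ 2)"
      using b(2)[of n] C by (intro mult_right_mono mult_left_mono) auto
    finally show ?thesis by simp
  qed
  have even_even: "norm (cf_approximant a (2 * Suc n) - cf_approximant a (2 * n)) \<le> 2 * C * (1 / real (n + 1) ^ 2)" for n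
  proof -
    \<comment> \<open>The terms with \<open>a (2 * n + 2)\<close> cancel, so the numerator is the
      determinant already met for neighbouring approximants.\<close>
    have "cf_num a (2 * n + 3) * cf_den a (2 * n + 1) - cf_num a (2 * n + 1) * cf_den a (2 * n + 3)
      = cf_num a (2 * n + 2) * cf_den a (2 * n + 1) - cf_num a (2 * n + 1) * cf_den a (2 * n + 2)"
      by (simp add: numeral_eq_Suc algebra_simps)
    then have "norm (cf_approximant a (2 * Suc n) - cf_approximant a (2 * n))
      = P n / (norm (cf_den a (2 * n + 3)) * norm (cf_den a (2 * n + 1)))"
      using even_nz[of n] even_nz[of "Suc n"] cf_determinant[of a "2 * n + 1"]
      by (simp add: cf_approximant_def diff_frac_eq norm_divide norm_mult P_def numeral_eq_Suc)
    \<comment> \<open>The bound at \<open>Suc n\<close> is weakened: n+2 drops to n+1, and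
      \<open>large\<close> allows replacing \<open>q n\<close> by \<open>b n\<close>. This
      \<open>b n\<close> in the denominator is cancelled by the one in \<open>P'\<close>, so small
      values of \<open>b\<close> do no harm.\<close>
    also have "\<dots> \<le> P n / ((real (n + 1) / 2 ^ (n + 1) * (Q n * b n)) * (real (n + 1) / 2 ^ n * Q n))"
    proof -
      have "Q n * b n \<le> Q (n + 1)"
        using large[of n] b(1)[of n] Q[of n] by (simp add: Q_def q_def mult_left_mono)
      then have "real (n + 1) / 2 ^ (n + 1) * (Q n * b n) \<le> real (Suc n + 1) / 2 ^ Suc n * Q (Suc n)"
        using Q[of n] b(1)[of n] by (intro mult_mono) (auto simp: field_simps)
      also have "\<dots> \<le> norm (cf_den a (2 * n + 3))"
        using even_lower[of "Suc n"] by (simp add: numeral_eq_Suc)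
      finally show ?thesis
        using even_lower[of n] even_nz[of n] even_nz[of "Suc n"] Q[of n] b(1)[of n] P0[of n]
        by (intro divide_left_mono mult_mono mult_pos_pos) (auto simp: numeral_eq_Suc)
    qed
    also have "\<dots> = P n * 4 ^ n / (b n * (Q n)\<^sup>2) * (2 / real (n + 1) ^ 2)"
      by (simp add: power2_eq_square mult.assoc mult.left_commute mult.commute flip: power_mult_distrib)
    also have "\<dots> \<le> C * (2 / real (n + 1) ^ 2)"
      using P'[of n] Q[of n] b(1)[of n] by (intro mult_right_mono) (auto simp: field_simps)
    finally show ?thesis by (simp add: mult.commute)
  qed

  have sq: "summable (\<lambda>n. 1 / real (n + 1) ^ 2)"
    using summable_ignore_initial_segment[OF inverse_power_summable[of 2, where 'a = real], of 1]
    by (simp add: inverse_eq_divide)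
  have "summable (\<lambda>n. cf_approximant a (2 * Suc n) - cf_approximant a (2 * n))"
    using even_even by (intro summable_comparison_test'[OF summable_mult[OF sq], of 0]) auto
  then have "convergent (\<lambda>n. cf_approximant a (2 * n))"
    unfolding summable_iff_convergent sum_lessThan_telescope[of "\<lambda>n. cf_approximant a (2 * n)"]
    by (simp add: convergent_diff_const_right_iff)
  then obtain L where L: "(\<lambda>n. cf_approximant a (2 * n)) \<longlonglongrightarrow> L"
    by (auto simp: convergent_def)
  have "(\<lambda>n. C * (1 / real (n + 1) ^ 2)) \<longlonglongrightarrow> 0"
    using tendsto_mult_right_zero[OF summable_LIMSEQ_zero[OF sq]] .
  then have "(\<lambda>n. cf_approximant a (2 * n + 1) - cf_approximant a (2 * n)) \<longlonglongrightarrow> 0"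
    by (rule Lim_null_comparison[rotated]) (use odd_even in simp)
  from tendsto_add[OF this L] have "(\<lambda>n. cf_approximant a (2 * n + 1)) \<longlonglongrightarrow> L"
    by simp
  with L have "convergent (cf_approximant a)"
    using limseq_even_odd[of "cf_approximant a" L] convergentI by auto
  with nz show ?thesis
    by (simp add: cf_converges_finite_def)
qed

theorem theorem3p1:
  fixes a :: "nat \<Rightarrow> complex" and c \<beta> :: "nat \<Rightarrow> real"
  assumes "\<forall>n\<ge>1. a n \<noteq> 0"
    and "\<forall>n\<ge>1. c n > 0"
    and "\<forall>n\<ge>1. 0 < \<beta> n \<and> \<beta> n < 1"
    and "(\<forall>n\<ge>1.
            norm (a (2 * n)) \<ge> (c n + 1) / (1 - \<beta> n) \<and>
            norm (a (2 * n + 1)) \<le>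
              Min {c n, c (n + 1),
                   \<beta> n * \<beta> (n + 1) * ((c (n + 1) + 1) / (4 * (1 - \<beta> (n + 1)))),
                   \<beta> n * \<beta> (n + 1) * ((c n + 1) / (4 * (1 - \<beta> n)))})
         \<or>
         (\<forall>n\<ge>1.
            norm (a (2 * n)) \<ge>
              Max {(c n + 1) / (1 - \<beta> n), (c (n + 1) + 1) / (1 - \<beta> (n + 1))} \<and>
            norm (a (2 * n + 1)) \<le>
              Min {c n, c (n + 1),
                   \<beta> n * \<beta> (n + 1) * ((c (n + 1) + 1) / (4 * (1 - \<beta> (n + 1))))})"
  shows "cf_converges_finite a"
proof -
  define g where "g n = (c n + 1) / (1 - \<beta> n)" for n
  note \<beta> = assms(3)[rule_format] and c = assms(2)[rule_format]
  have large: "norm (a (2 * n)) \<ge> g n" if "n \<ge> 1" for n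
    using assms(4) that unfolding g_def by auto
  have small: "norm (a (2 * n + 1)) \<le> c n" "norm (a (2 * n + 1)) \<le> c (n + 1)" if "n \<ge> 1" for n
    using assms(4) that by auto
  have scale: "x \<le> \<beta> n * \<beta> (n + 1) * norm (a m) / 4"
    if "x \<le> \<beta> n * \<beta> (n + 1) * ((c k + 1) / (4 * (1 - \<beta> k)))" "g k \<le> norm (a m)" "n \<ge> 1" for x n m k
  proof -
    have "x \<le> \<beta> n * \<beta> (n + 1) * g k / 4"
      using that(1) by (simp add: g_def mult_ac)
    also have "\<dots> \<le> \<beta> n * \<beta> (n + 1) * norm (a m) / 4"
      using that(2,3) \<beta>[of n] \<beta>[of "n + 1"] by (simp add: mult_left_mono)
    finally show ?thesis .
  qed
  have right: "norm (a (2 * n + 1)) \<le> \<beta> n * \<beta> (n + 1) * norm (a (2 * (n + 1))) / 4" if "n \<ge> 1" for n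
    using assms(4) that large[of "n + 1"] by (intro scale[of _ n "n + 1"]) auto
  \<comment> \<open>Here the alternatives differ. The first has a minimum entry built from
    \<open>g n\<close>; in the second, the maximum gives
    \<open>g (n + 1) \<le> norm (a (2 * n))\<close>, so the entry built from
    \<open>g (n + 1)\<close> suffices.\<close>
  have left: "norm (a (2 * n + 1)) \<le> \<beta> n * \<beta> (n + 1) * norm (a (2 * n)) / 4" if "n \<ge> 1" for n
    using assms(4)
  proof
    assume "\<forall>n\<ge>1. norm (a (2 * n)) \<ge> (c n + 1) / (1 - \<beta> n) \<and> norm (a (2 * n + 1)) \<le>
              Min {c n, c (n + 1),
                   \<beta> n * \<beta> (n + 1) * ((c (n + 1) + 1) / (4 * (1 - \<beta> (n + 1)))),
                   \<beta> n * \<beta> (n + 1) * ((c n + 1) / (4 * (1 - \<beta> n)))}"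
    then show ?thesis
      using that large[of n] by (intro scale[of _ n n]) auto
  next
    assume "\<forall>n\<ge>1. norm (a (2 * n)) \<ge>
              Max {(c n + 1) / (1 - \<beta> n), (c (n + 1) + 1) / (1 - \<beta> (n + 1))} \<and>
            norm (a (2 * n + 1)) \<le>
              Min {c n, c (n + 1),
                   \<beta> n * \<beta> (n + 1) * ((c (n + 1) + 1) / (4 * (1 - \<beta> (n + 1))))}"
    then show ?thesis
      using that by (intro scale[of _ n "n + 1"]) (auto simp: g_def)
  qed
  \<comment> \<open>The perturbation \<open>1 + z\<close> has norm at most \<open>c n + 1\<close>,
    hence at most the fraction \<open>1 - \<beta> n\<close> of
    \<open>norm (a (2 * n))\<close>.\<close>
  have lower: "norm (1 + z + a (2 * n)) \<ge> \<beta> n * norm (a (2 * n))" if "norm z \<le> c n" "n \<ge> 1" for z n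
  proof -
    have "c n + 1 \<le> (1 - \<beta> n) * norm (a (2 * n))"
      using large[OF that(2)] \<beta>[OF that(2)] by (simp add: g_def field_simps)
    moreover have "norm (a (2 * n)) - norm (1 + z) \<le> norm (1 + z + a (2 * n))"
      by (metis add.commute norm_diff_ineq)
    moreover have "norm (1 + z) \<le> 1 + norm z"
      by (metis norm_one norm_triangle_ineq)
    ultimately show ?thesis
      using that(1) by (simp add: algebra_simps)
  qed
  show ?thesis
  proof (rule cf_converges_finite_of_bounds[where b = "\<lambda>n. \<beta> (n + 1)"])
    fix n
    show "0 < \<beta> (n + 1)" "\<beta> (n + 1) \<le> 1"
      using \<beta>[of "n + 1"] by auto
    have "1 \<le> g (n + 1)"
      using \<beta>[of "n + 1"] c[of "n + 1"] by (simp add: g_def)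
    then show "norm (a (2 * n + 2)) \<ge> 1"
      using large[of "n + 1"] by simp
    show "norm (1 + a 2) \<ge> \<beta> (0 + 1) * norm (a 2)"
      using lower[of 0 1] c[of 1] by (simp add: numeral_2_eq_2)
    \<comment> \<open>The odd-indexed element acts as the perturbation of its right neighbour here
      and of its left neighbour in the next claim; hence it is bounded by both
      \<open>c (n + 2)\<close> and \<open>c (n + 1)\<close>.\<close>
    show "norm (1 + a (2 * n + 3) + a (2 * n + 4)) \<ge> \<beta> (n + 1 + 1) * norm (a (2 * n + 4))"
      using lower[of "a (2 * n + 3)" "n + 2"] small(2)[of "n + 1"] by (simp add: numeral_eq_Suc)
    show "norm (1 + a (2 * n + 2) + a (2 * n + 3)) \<ge> \<beta> (n + 1) * norm (a (2 * n + 2))"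
      using lower[of "a (2 * n + 3)" "n + 1"] small(1)[of "n + 1"]
      by (simp add: numeral_eq_Suc add_ac)
    show "norm (a (2 * n + 3)) \<le> \<beta> (n + 1) * \<beta> (n + 1 + 1) * norm (a (2 * n + 2)) / 4"
      using left[of "n + 1"] by (simp add: numeral_eq_Suc)
    show "norm (a (2 * n + 3)) \<le> \<beta> (n + 1) * \<beta> (n + 1 + 1) * norm (a (2 * n + 4)) / 4"
      using right[of "n + 1"] by (simp add: numeral_eq_Suc)
  qed
qed

end
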